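(* Let $A_0\in M_n^h(\mathbb{C})$ and, for $x\in\mathbb{R}^n$, let $A(x)=A_0+\mathrm{Diag}(x)$ and $$\bar A[x]=\begin{bmatrix}\Re(A_0)&-\Im(A_0)\\ \Im(A_0)&\Re(A_0)\end{bmatrix}+\begin{bmatrix}\mathrm{Diag}(x)&0\\0&\mathrm{Diag}(x)\end{bmatrix}\in\mathbb{R}^{2n\times2n}.$$ Then the problem $\min_{x\in\mathbb{R}^n}\max_{1\le i\le n}|\lambda_i(A(x))|$ is equivalent to the real semidefinite program $$\min_{w\in\mathbb{R},\,x\in\mathbb{R}^n}w\quad\text{such that}\quad w\begin{bmatrix}I&0\\0&I\end{bmatrix}-\bar A[x]\ge0\ \text{ and }\ w\begin{bmatrix}I&0\\0&I\end{bmatrix}+\bar A[x]\ge0,$$ in the sense that the two problems have the same optimal value, and $x$ solves the first problem if and only if $(w,x)$ solves the second for $w=\max_{1\le i\le n}|\lambda_i(A(x))|$.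
   Context: $M_n^h(\mathbb{C})$ is the set of Hermitian $n\times n$ complex matrices, $\lambda_i(A(x))$ are the eigenvalues of $A(x)$, and $\mathrm{Diag}(x)$ is the diagonal matrix with diagonal $x$. For a matrix $Y$, $\Re(Y)=\frac12(Y+\overline{Y})$ and $\Im(Y)=\frac1{2i}(Y-\overline{Y})$. The inequality $M\ge0$ means $M$ is positive semidefinite. *)

theory Defs
  imports
    "HOL-Library.Extended_Real"
    "Jordan_Normal_Form.Schur_Decomposition"
    "Jordan_Normal_Form.Spectral_Radius"
begin

definition hermitian_mat :: "nat \<Rightarrow> complex mat \<Rightarrow> bool" where
  "hermitian_mat n A \<longleftrightarrow> A \<in> carrier_mat n n \<and> mat_adjoint A = A"

definition real_psd :: "real mat \<Rightarrow> bool" where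
  "real_psd M \<longleftrightarrow> square_mat M \<and> transpose_mat M = M \<and>
     (\<forall>v \<in> carrier_vec (dim_row M). 0 \<le> v \<bullet> (M *\<^sub>v v))"

definition Diag :: "'a::zero vec \<Rightarrow> 'a mat" where
  "Diag x = mat_diag (dim_vec x) (\<lambda>i. x $ i)"

definition A_shift :: "complex mat \<Rightarrow> real vec \<Rightarrow> complex mat" where
  "A_shift A0 x = A0 + Diag (map_vec complex_of_real x)"

text \<open>The real and imaginary parts of a matrix are taken entrywise, as real matrices.\<close>

definition A_bar :: "nat \<Rightarrow> complex mat \<Rightarrow> real vec \<Rightarrow> real mat" where
  "A_bar n A0 x =
     four_block_mat (map_mat Re A0) (- map_mat Im A0) (map_mat Im A0) (map_mat Re A0) +
     four_block_mat (Diag x) (0\<^sub>m n n) (0\<^sub>m n n) (Diag x)"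

text \<open>The library's \<^const>\<open>spectral_radius\<close> is the maximum of the norms over the set of eigenvalues;
  repeating eigenvalues by multiplicity does not change this maximum.\<close>

definition max_abs_eigenvalue :: "complex mat \<Rightarrow> real vec \<Rightarrow> real" where
  "max_abs_eigenvalue A0 x = spectral_radius (A_shift A0 x)"

definition sdp_feasible :: "nat \<Rightarrow> complex mat \<Rightarrow> (real \<times> real vec) set" where
  "sdp_feasible n A0 = {(w, x). x \<in> carrier_vec n \<and>
     real_psd (w \<cdot>\<^sub>m four_block_mat (1\<^sub>m n) (0\<^sub>m n n) (0\<^sub>m n n) (1\<^sub>m n) - A_bar n A0 x) \<and>
     real_psd (w \<cdot>\<^sub>m four_block_mat (1\<^sub>m n) (0\<^sub>m n n) (0\<^sub>m n n) (1\<^sub>m n) + A_bar n A0 x)}"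

text \<open>The optimal value is an extended real, so that infeasible or unbounded
  problems do not receive an arbitrary value.\<close>

definition optimal_value :: "('a \<Rightarrow> real) \<Rightarrow> 'a set \<Rightarrow> ereal" where
  "optimal_value f S = (INF y\<in>S. ereal (f y))"

definition solves :: "('a \<Rightarrow> real) \<Rightarrow> 'a set \<Rightarrow> 'a \<Rightarrow> bool" where
  "solves f S y \<longleftrightarrow> is_arg_min f (\<lambda>z. z \<in> S) y"

end

theory Submission
  imports Defs
begin

text \<open>Writing \<open>z = a + i b\<close>, the quadratic form of the real block matrix at \<open>(a, b)\<close> is
  \<open>Re \<langle>A(x) z, z\<rangle>\<close>, so \<open>(w, x)\<close> is feasible iff \<open>\<bar>\<langle>A(x) z, z\<rangle>\<bar> \<le> w \<parallel>z\<parallel>\<^sup>2\<close> for all \<open>z\<close>, which for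
  Hermitian \<open>A(x)\<close> means that its spectral radius is at most \<open>w\<close>. An eigenvector gives one
  direction. The other avoids unitary diagonalisation: if \<open>B = A(x) / w\<close> has spectral radius below 1,
  its powers are bounded, and \<open>q k = \<parallel>B\<^sup>k z\<parallel>\<^sup>2\<close> is a bounded convex sequence, since
  \<open>q (k + 1) = Re \<langle>B\<^sup>k z, B\<^sup>k\<^sup>+\<^sup>2 z\<rangle>\<close>. Hence \<open>q 1 \<le> q 0\<close>, and
  \<open>2 \<bar>Re \<langle>B z, z\<rangle>\<bar> \<le> q 1 + q 0 \<le> 2 q 0\<close>.\<close>

section \<open>The Hermitian inner product on complex vectors\<close>

lemma cscalar_prod_sum:
  fixes u v :: "complex vec"
  assumes "u \<in> carrier_vec n" "v \<in> carrier_vec n"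
  shows "u \<bullet>c v = (\<Sum>i<n. u $ i * cnj (v $ i))"
  using assms by (auto simp: scalar_prod_def atLeast0LessThan intro!: sum.cong)

lemma Re_cscalar_prod_self:
  fixes u :: "complex vec"
  assumes "u \<in> carrier_vec n"
  shows "Re (u \<bullet>c u) = (\<Sum>i<n. (cmod (u $ i))\<^sup>2)"
  unfolding cscalar_prod_sum[OF assms assms]
  by (simp add: cmod_power2 flip: power2_eq_square)

lemma Re_cscalar_prod_self_pos:
  fixes u :: "complex vec"
  assumes u: "u \<in> carrier_vec n" and nz: "u \<noteq> 0\<^sub>v n"
  shows "0 < Re (u \<bullet>c u)"
proof -
  obtain i where "i < n" "u $ i \<noteq> 0"
    using u nz by (metis carrier_vecD eq_vecI index_zero_vec)
  then show ?thesis
    unfolding Re_cscalar_prod_self[OF u] by (intro sum_pos2[of _ i]) auto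
qed

text \<open>A Cauchy-Schwarz bound in additive form: summing the entrywise inequality between
  geometric and arithmetic mean avoids square roots and gives exactly the convexity inequality
  needed for squared norms along an orbit.\<close>

lemma abs_Re_cscalar_prod_le:
  fixes u v :: "complex vec"
  assumes u: "u \<in> carrier_vec n" and v: "v \<in> carrier_vec n"
  shows "2 * \<bar>Re (u \<bullet>c v)\<bar> \<le> Re (u \<bullet>c u) + Re (v \<bullet>c v)"
proof -
  have term_le: "2 * \<bar>Re (a * cnj b)\<bar> \<le> (cmod a)\<^sup>2 + (cmod b)\<^sup>2" for a b :: complex
  proof -
    have "\<bar>Re (a * cnj b)\<bar> \<le> cmod a * cmod b"
      using abs_Re_le_cmod[of "a * cnj b"] by (simp add: norm_mult)
    then show ?thesis
      using sum_squares_bound[of "cmod a" "cmod b"] by linarith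
  qed
  have "2 * \<bar>Re (u \<bullet>c v)\<bar> \<le> (\<Sum>i<n. 2 * \<bar>Re (u $ i * cnj (v $ i))\<bar>)"
    unfolding cscalar_prod_sum[OF u v] Re_sum sum_distrib_left[symmetric]
    by (intro mult_left_mono sum_abs) simp
  also have "\<dots> \<le> (\<Sum>i<n. (cmod (u $ i))\<^sup>2 + (cmod (v $ i))\<^sup>2)"
    by (intro sum_mono term_le)
  also have "\<dots> = Re (u \<bullet>c u) + Re (v \<bullet>c v)"
    by (simp only: sum.distrib Re_cscalar_prod_self[OF u] Re_cscalar_prod_self[OF v])
  finally show ?thesis .
qed

section \<open>Hermitian matrices as self-adjoint operators\<close>

lemma mult_mat_vec_sum:
  assumes "A \<in> carrier_mat m n" "v \<in> carrier_vec n" "i < m"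
  shows "(A *\<^sub>v v) $ i = (\<Sum>j<n. A $$ (i, j) * v $ j)"
  using assms by (auto simp: scalar_prod_def atLeast0LessThan intro!: sum.cong)

lemma hermitian_mat_iff:
  "hermitian_mat n A \<longleftrightarrow>
     A \<in> carrier_mat n n \<and> (\<forall>i<n. \<forall>j<n. cnj (A $$ (j, i)) = A $$ (i, j))"
proof -
  have adj: "mat_adjoint A $$ (i, j) = cnj (A $$ (j, i))"
    if "A \<in> carrier_mat n n" "i < n" "j < n" for i j
    using that by (simp add: mat_adjoint_def mat_of_rows_index)
  have dims: "mat_adjoint A \<in> carrier_mat n n" if "A \<in> carrier_mat n n"
    using that by (auto simp: mat_adjoint_def)
  show ?thesis
  proof (cases "A \<in> carrier_mat n n")
    case True
    have "mat_adjoint A = A \<longleftrightarrow> (\<forall>i<n. \<forall>j<n. mat_adjoint A $$ (i, j) = A $$ (i, j))"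
      using True dims[OF True] by (auto intro!: eq_matI)
    with True show ?thesis
      by (auto simp: hermitian_mat_def adj)
  qed (simp add: hermitian_mat_def)
qed

lemma hermitian_mat_cscalar_prod:
  assumes "hermitian_mat n A" and u: "u \<in> carrier_vec n" and v: "v \<in> carrier_vec n"
  shows "(A *\<^sub>v u) \<bullet>c v = u \<bullet>c (A *\<^sub>v v)"
proof -
  have A: "A \<in> carrier_mat n n" and sym: "\<And>i j. i < n \<Longrightarrow> j < n \<Longrightarrow> cnj (A $$ (j, i)) = A $$ (i, j)"
    using assms(1) unfolding hermitian_mat_iff by blast+
  have Au: "A *\<^sub>v u \<in> carrier_vec n" and Av: "A *\<^sub>v v \<in> carrier_vec n"
    using A u v by auto
  have "(A *\<^sub>v u) \<bullet>c v = (\<Sum>i<n. \<Sum>j<n. A $$ (i, j) * u $ j * cnj (v $ i))"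
    by (simp add: cscalar_prod_sum[OF Au v] mult_mat_vec_sum[OF A u] sum_distrib_right
        del: index_mult_mat_vec)
  also have "\<dots> = (\<Sum>j<n. \<Sum>i<n. A $$ (i, j) * u $ j * cnj (v $ i))"
    by (rule sum.swap)
  also have "\<dots> = (\<Sum>j<n. \<Sum>i<n. u $ j * cnj (A $$ (j, i) * v $ i))"
    by (intro sum.cong refl) (simp add: sym mult_ac)
  also have "\<dots> = u \<bullet>c (A *\<^sub>v v)"
    by (simp add: cscalar_prod_sum[OF u Av] mult_mat_vec_sum[OF A v] sum_distrib_left
        del: index_mult_mat_vec)
  finally show ?thesis .
qed

lemma hermitian_mat_smult:
  assumes "hermitian_mat n A"
  shows "hermitian_mat n (complex_of_real c \<cdot>\<^sub>m A)"
  using assms by (auto simp: hermitian_mat_iff)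

section \<open>Quadratic forms and the spectral radius\<close>

lemma spectral_radius_less_1_orbit_bounded:
  fixes B :: "complex mat"
  assumes B: "B \<in> carrier_mat n n" and "spectral_radius B < 1" and z: "z \<in> carrier_vec n"
  shows "\<exists>K. \<forall>k. Re ((B ^\<^sub>m k *\<^sub>v z) \<bullet>c (B ^\<^sub>m k *\<^sub>v z)) \<le> K"
proof -
  \<comment> \<open>The Jordan normal form yields a single \<open>c\<close> that bounds every entry
    of every power of \<open>B\<close>; the bound on the orbit then follows entry by entry.\<close>
  obtain c where c: "\<And>k. norm_bound (B ^\<^sub>m k) c"
    using spectral_radius_jnf_norm_bound_less_1_upper_triangular[OF B assms(2)] by blast
  have Bk: "B ^\<^sub>m k \<in> carrier_mat n n" for k
    using B by (simp add: pow_carrier_mat)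
  have entry: "cmod ((B ^\<^sub>m k *\<^sub>v z) $ i) \<le> (\<Sum>j<n. c * cmod (z $ j))" if "i < n" for k i
  proof -
    have ub: "cmod ((B ^\<^sub>m k) $$ (i, j)) \<le> c" if "j < n" for j
      using c[of k] carrier_matD[OF Bk[of k]] \<open>i < n\<close> that unfolding norm_bound_def by metis
    have "cmod (\<Sum>j<n. (B ^\<^sub>m k) $$ (i, j) * z $ j)
            \<le> (\<Sum>j<n. cmod ((B ^\<^sub>m k) $$ (i, j) * z $ j))"
      by (rule norm_sum)
    also have "\<dots> \<le> (\<Sum>j<n. c * cmod (z $ j))"
      by (intro sum_mono) (auto simp: norm_mult ub intro!: mult_right_mono)
    finally show ?thesis
      using mult_mat_vec_sum[OF Bk z \<open>i < n\<close>] by simp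
  qed
  have "Re ((B ^\<^sub>m k *\<^sub>v z) \<bullet>c (B ^\<^sub>m k *\<^sub>v z)) \<le> (\<Sum>i<n. (\<Sum>j<n. c * cmod (z $ j))\<^sup>2)" for k
  proof -
    have "B ^\<^sub>m k *\<^sub>v z \<in> carrier_vec n" using mult_mat_vec_carrier[OF Bk z] .
    from Re_cscalar_prod_self[OF this] show ?thesis
      by (simp only:) (intro sum_mono power_mono entry, auto)
  qed
  then show ?thesis by blast
qed

text \<open>Convexity makes the increments nondecreasing, so a positive first increment would force
  at least linear growth and break the upper bound.\<close>

lemma convex_bounded_seq_le:
  fixes q :: "nat \<Rightarrow> real"
  assumes convex: "\<And>k. 2 * q (Suc k) \<le> q k + q (Suc (Suc k))" and bounded: "\<And>k. q k \<le> K"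
  shows "q 1 \<le> q 0"
proof (rule ccontr)
  assume "\<not> q 1 \<le> q 0"
  then have pos: "q 1 - q 0 > 0" by simp
  have step: "q 1 - q 0 \<le> q (Suc k) - q k" for k
  proof (induction k)
    case (Suc k)
    then show ?case using convex[of k] by linarith
  qed simp
  have "q 0 + real k * (q 1 - q 0) \<le> q k" for k
  proof (induction k)
    case (Suc k)
    then show ?case using step[of k] by (simp add: algebra_simps)
  qed simp
  moreover obtain k where "K - q 0 < real k * (q 1 - q 0)"
    using reals_Archimedean3[OF pos] by blast
  ultimately show False using bounded[of k] by (smt (verit))
qed

lemma hermitian_mat_contraction:
  assumes herm: "hermitian_mat n B" and "spectral_radius B < 1" and z: "z \<in> carrier_vec n"
  shows "\<bar>Re ((B *\<^sub>v z) \<bullet>c z)\<bar> \<le> Re (z \<bullet>c z)"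
proof -
  have B: "B \<in> carrier_mat n n" using herm by (simp add: hermitian_mat_def)
  define u where "u k = B ^\<^sub>m k *\<^sub>v z" for k
  have Bk: "B ^\<^sub>m k \<in> carrier_mat n n" for k
    using B by (simp add: pow_carrier_mat)
  have u: "u k \<in> carrier_vec n" for k
    unfolding u_def using mult_mat_vec_carrier[OF Bk z] .
  have u0: "u 0 = z" using B z by (simp add: u_def)
  \<comment> \<open>Matrix powers multiply the new factor on the right, whereas the recursion for
    the orbit needs it on the left.\<close>
  have pow_comm: "B ^\<^sub>m Suc k = B * B ^\<^sub>m k" for k
  proof (induction k)
    case (Suc k)
    have "B ^\<^sub>m Suc (Suc k) = (B * B ^\<^sub>m k) * B" using Suc by simp
    also have "\<dots> = B * B ^\<^sub>m Suc k" using assoc_mult_mat[OF B Bk B] by simp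
    finally show ?case .
  qed (use B in simp)
  have u_Suc: "u (Suc k) = B *\<^sub>v u k" for k
    unfolding u_def pow_comm using assoc_mult_mat_vec[OF B Bk z] .
  define q where "q k = Re (u k \<bullet>c u k)" for k
  have "2 * q (Suc k) \<le> q k + q (Suc (Suc k))" for k
  proof -
    \<comment> \<open>Self-adjointness carries one \<open>B\<close> from the left factor to the
      right one, turning a squared norm into an inner product of vectors two steps apart.\<close>
    have "u (Suc k) \<bullet>c u (Suc k) = u k \<bullet>c u (Suc (Suc k))"
      using hermitian_mat_cscalar_prod[OF herm u u, of k "Suc k"] by (simp add: u_Suc)
    then show ?thesis
      using abs_Re_cscalar_prod_le[OF u u, of k "Suc (Suc k)"] by (simp add: q_def)
  qed
  moreover obtain K where "\<And>k. q k \<le> K"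
    using spectral_radius_less_1_orbit_bounded[OF B assms(2) z] unfolding q_def u_def by blast
  ultimately have "q 1 \<le> q 0" by (rule convex_bounded_seq_le)
  then show ?thesis
    using abs_Re_cscalar_prod_le[OF u u, of "Suc 0" 0] by (simp add: q_def u_Suc u0)
qed

text \<open>An eigenvector of the scaled matrix for \<mu> is an eigenvector of \<open>A\<close> for
  \<open>w * \<mu>\<close>, so \<open>w * cmod \<mu>\<close> is at most the spectral radius of
  \<open>A\<close>. Positivity of \<open>n\<close> provides an eigenvalue of maximal
  modulus.\<close>

lemma spectral_radius_smult_inverse_less_1:
  assumes A: "A \<in> carrier_mat n n" and n: "n > 0" and "spectral_radius A < w" "0 < w"
  shows "spectral_radius (complex_of_real (1 / w) \<cdot>\<^sub>m A) < 1"
proof -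
  let ?B = "complex_of_real (1 / w) \<cdot>\<^sub>m A"
  have B: "?B \<in> carrier_mat n n" using A by simp
  obtain \<mu> v where r: "spectral_radius ?B = cmod \<mu>" and ev: "eigenvector ?B v \<mu>"
    using spectral_radius_mem_max(1)[OF B n] by (auto simp: spectrum_def eigenvalue_def)
  then have v: "v \<in> carrier_vec n" "v \<noteq> 0\<^sub>v n" and eq: "?B *\<^sub>v v = \<mu> \<cdot>\<^sub>v v"
    using A by (auto simp: eigenvector_def)
  have "A *\<^sub>v v = (w * \<mu>) \<cdot>\<^sub>v v"
  proof (rule eq_vecI)
    fix i assume "i < dim_vec ((w * \<mu>) \<cdot>\<^sub>v v)"
    then have i: "i < n" using v by simp
    have "(?B *\<^sub>v v) $ i = \<mu> * v $ i" using eq i v by simp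
    moreover have "(?B *\<^sub>v v) $ i = complex_of_real (1 / w) * (A *\<^sub>v v) $ i"
      using i A v by (simp add: scalar_prod_def sum_distrib_left mult_ac)
    ultimately show "(A *\<^sub>v v) $ i = ((w * \<mu>) \<cdot>\<^sub>v v) $ i"
      using i v \<open>0 < w\<close> by (simp add: field_simps)
  qed (use A v in auto)
  then have "w * \<mu> \<in> spectrum A"
    using A v by (auto simp: spectrum_def eigenvalue_def eigenvector_def)
  then have "w * cmod \<mu> \<le> spectral_radius A"
    using \<open>0 < w\<close> by (intro spectral_radius_mem_max(2)[OF A n]) (force simp: norm_mult)
  then have "w * cmod \<mu> < w * 1" using assms by linarith
  then show ?thesis using \<open>0 < w\<close> unfolding r by (rule mult_left_less_imp_less[OF _ less_imp_le])
qed

lemma spectral_radius_nonneg: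
  assumes "A \<in> carrier_mat n n" "n > 0"
  shows "0 \<le> spectral_radius A"
  using spectral_radius_mem_max(1)[OF assms] by auto

text \<open>The contraction bound wants a spectral radius strictly below 1. Hence \<open>A\<close>
  is divided by an arbitrary \<open>w\<close> above its spectral radius, and \<open>w\<close> is
  then let down to that radius. Writing the bound as a quotient for \<open>dense_ge\<close> requires
  nonzero \<open>z\<close>, so the zero vector is treated apart.\<close>

lemma hermitian_mat_quadratic_form_le:
  assumes herm: "hermitian_mat n A" and n: "n > 0" and z: "z \<in> carrier_vec n"
  shows "\<bar>Re ((A *\<^sub>v z) \<bullet>c z)\<bar> \<le> spectral_radius A * Re (z \<bullet>c z)"
proof (cases "z = 0\<^sub>v n")
  case True
  then show ?thesis
    using herm by (auto simp: hermitian_mat_def scalar_prod_def)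
next
  case False
  let ?r = "Re ((A *\<^sub>v z) \<bullet>c z)"
  have pos: "0 < Re (z \<bullet>c z)" using Re_cscalar_prod_self_pos[OF z False] .
  have A: "A \<in> carrier_mat n n" using herm by (simp add: hermitian_mat_def)
  have "\<bar>?r\<bar> / Re (z \<bullet>c z) \<le> spectral_radius A"
  proof (rule dense_ge)
    fix w assume w: "spectral_radius A < w"
    then have w0: "0 < w" using spectral_radius_nonneg[OF A n] by linarith
    let ?B = "complex_of_real (1 / w) \<cdot>\<^sub>m A"
    have "(?B *\<^sub>v z) \<bullet>c z = complex_of_real (1 / w) * ((A *\<^sub>v z) \<bullet>c z)"
      using A z by (simp add: scalar_prod_def sum_distrib_left mult_ac)
    then have "Re ((?B *\<^sub>v z) \<bullet>c z) = ?r / w" by simp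
    with hermitian_mat_contraction[OF hermitian_mat_smult[OF herm]
        spectral_radius_smult_inverse_less_1[OF A n w w0] z]
    have "\<bar>?r / w\<bar> \<le> Re (z \<bullet>c z)" by metis
    then show "\<bar>?r\<bar> / Re (z \<bullet>c z) \<le> w"
      using w0 pos by (simp add: field_simps)
  qed
  then show ?thesis using pos by (simp add: field_simps)
qed

text \<open>For the converse it suffices to test the form on one eigenvector whose eigenvalue has
  maximal modulus.\<close>

lemma hermitian_mat_spectral_radius_le_iff:
  assumes herm: "hermitian_mat n A" and n: "n > 0"
  shows "spectral_radius A \<le> w \<longleftrightarrow>
    (\<forall>z \<in> carrier_vec n. \<bar>Re ((A *\<^sub>v z) \<bullet>c z)\<bar> \<le> w * Re (z \<bullet>c z))"
proof
  assume le: "spectral_radius A \<le> w"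
  show "\<forall>z \<in> carrier_vec n. \<bar>Re ((A *\<^sub>v z) \<bullet>c z)\<bar> \<le> w * Re (z \<bullet>c z)"
  proof
    fix z :: "complex vec" assume z: "z \<in> carrier_vec n"
    have "0 \<le> Re (z \<bullet>c z)" by (simp add: Re_cscalar_prod_self[OF z] sum_nonneg)
    with hermitian_mat_quadratic_form_le[OF herm n z] mult_right_mono[OF le]
    show "\<bar>Re ((A *\<^sub>v z) \<bullet>c z)\<bar> \<le> w * Re (z \<bullet>c z)" by fastforce
  qed
next
  assume bound: "\<forall>z \<in> carrier_vec n. \<bar>Re ((A *\<^sub>v z) \<bullet>c z)\<bar> \<le> w * Re (z \<bullet>c z)"
  have A: "A \<in> carrier_mat n n" using herm by (simp add: hermitian_mat_def)
  obtain \<mu> z where r: "spectral_radius A = cmod \<mu>" and ev: "eigenvector A z \<mu>"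
    using spectral_radius_mem_max(1)[OF A n] by (auto simp: spectrum_def eigenvalue_def)
  then have z: "z \<in> carrier_vec n" "z \<noteq> 0\<^sub>v n" and eq: "A *\<^sub>v z = \<mu> \<cdot>\<^sub>v z"
    using A by (auto simp: eigenvector_def)
  have pos: "0 < Re (z \<bullet>c z)" using Re_cscalar_prod_self_pos[OF z] .
  have Im0: "Im (z \<bullet>c z) = 0" by (simp add: cscalar_prod_sum[OF z(1) z(1)])
  have l: "(A *\<^sub>v z) \<bullet>c z = \<mu> * (z \<bullet>c z)"
    using z by (simp add: eq scalar_prod_def sum_distrib_left mult_ac)
  \<comment> \<open>In the second argument the eigenvalue comes out conjugated. Comparing both
    evaluations shows that \<mu> is real, so its modulus is the absolute value of its real part,
    which is all that the bound controls.\<close>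
  have "z \<bullet>c (A *\<^sub>v z) = cnj \<mu> * (z \<bullet>c z)"
    using z by (simp add: eq scalar_prod_def sum_distrib_left mult_ac)
  with l hermitian_mat_cscalar_prod[OF herm z(1) z(1)]
  have "\<mu> * (z \<bullet>c z) = cnj \<mu> * (z \<bullet>c z)" by metis
  moreover have "z \<bullet>c z \<noteq> 0" using pos by auto
  ultimately have "\<mu> = cnj \<mu>" by (metis mult_right_cancel)
  then have Im\<mu>: "Im \<mu> = 0" by (simp add: complex_eq_iff)
  have "\<bar>Re \<mu>\<bar> * Re (z \<bullet>c z) \<le> w * Re (z \<bullet>c z)"
    using bound[rule_format, OF z(1)] pos by (simp add: l Im0 abs_mult)
  then have "\<bar>Re \<mu>\<bar> \<le> w" using pos by simp
  then show "spectral_radius A \<le> w" using Im\<mu> by (simp add: r cmod_eq_Re)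
qed

section \<open>Complex matrices as real block matrices\<close>

definition realification :: "complex mat \<Rightarrow> real mat" where
  "realification H =
     four_block_mat (map_mat Re H) (- map_mat Im H) (map_mat Im H) (map_mat Re H)"

definition realify_vec :: "complex vec \<Rightarrow> real vec" where
  "realify_vec z = map_vec Re z @\<^sub>v map_vec Im z"

lemma realification_carrier [simp]:
  "H \<in> carrier_mat n n \<Longrightarrow> realification H \<in> carrier_mat (n + n) (n + n)"
  by (simp add: realification_def)

lemma realify_vec_carrier [simp]:
  "z \<in> carrier_vec n \<Longrightarrow> realify_vec z \<in> carrier_vec (n + n)"
  by (simp add: realify_vec_def)

text \<open>Surjectivity lets the quantifier over real vectors in \<open>real_psd\<close> be
  replaced by one over complex vectors.\<close>

lemma realify_vec_image: "realify_vec ` carrier_vec n = carrier_vec (n + n)"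
proof
  show "carrier_vec (n + n) \<subseteq> realify_vec ` carrier_vec n"
  proof
    fix v :: "real vec" assume v: "v \<in> carrier_vec (n + n)"
    let ?z = "vec n (\<lambda>i. Complex (v $ i) (v $ (n + i)))"
    have "v = realify_vec ?z"
      using v by (intro eq_vecI) (auto simp: realify_vec_def)
    then show "v \<in> realify_vec ` carrier_vec n" by (metis imageI vec_carrier)
  qed
qed auto

lemma realify_vec_scalar_prod:
  assumes u: "u \<in> carrier_vec n" and z: "z \<in> carrier_vec n"
  shows "realify_vec z \<bullet> realify_vec u = Re (u \<bullet>c z)"
proof -
  have "realify_vec z \<bullet> realify_vec u
          = map_vec Re z \<bullet> map_vec Re u + map_vec Im z \<bullet> map_vec Im u"
    unfolding realify_vec_def using u z by (intro scalar_prod_append) auto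
  then show ?thesis
    using u z by (simp add: cscalar_prod_sum[OF u z] scalar_prod_def atLeast0LessThan
        sum.distrib mult.commute)
qed

text \<open>The block rows are the formulas for the real and the imaginary part of a complex
  product, so the block matrix is \<open>H\<close> itself seen as a real linear map.\<close>

lemma realification_mult_realify_vec:
  assumes H: "H \<in> carrier_mat n n" and z: "z \<in> carrier_vec n"
  shows "realification H *\<^sub>v realify_vec z = realify_vec (H *\<^sub>v z)"
proof -
  have "realification H *\<^sub>v realify_vec z =
      (map_mat Re H *\<^sub>v map_vec Re z + (- map_mat Im H) *\<^sub>v map_vec Im z) @\<^sub>v
      (map_mat Im H *\<^sub>v map_vec Re z + map_mat Re H *\<^sub>v map_vec Im z)"
    unfolding realification_def realify_vec_def
    using H z by (intro four_block_mat_mult_vec) auto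
  also have "map_mat Re H *\<^sub>v map_vec Re z + (- map_mat Im H) *\<^sub>v map_vec Im z = map_vec Re (H *\<^sub>v z)"
    using H z by (intro eq_vecI) (auto simp: scalar_prod_def sum_negf sum_subtractf)
  also have "map_mat Im H *\<^sub>v map_vec Re z + map_mat Re H *\<^sub>v map_vec Im z = map_vec Im (H *\<^sub>v z)"
    using H z by (intro eq_vecI) (auto simp: scalar_prod_def sum.distrib)
  finally show ?thesis by (simp add: realify_vec_def)
qed

text \<open>The real part of a Hermitian matrix is symmetric and its imaginary part antisymmetric;
  the opposite signs of the off-diagonal blocks absorb the antisymmetry.\<close>

lemma transpose_realification:
  assumes "hermitian_mat n H"
  shows "transpose_mat (realification H) = realification H"
proof -
  have H: "H \<in> carrier_mat n n" and sym: "\<And>i j. i < n \<Longrightarrow> j < n \<Longrightarrow> cnj (H $$ (j, i)) = H $$ (i, j)"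
    using assms unfolding hermitian_mat_iff by blast+
  have ReIm: "Re (H $$ (i, j)) = Re (H $$ (j, i))" "- Im (H $$ (i, j)) = Im (H $$ (j, i))"
    if "i < n" "j < n" for i j
    using sym[OF that] by (metis cnj.sel, metis cnj.sel minus_minus)
  show ?thesis
    using H by (intro eq_matI) (auto simp: realification_def ReIm intro: ReIm(1))
qed

lemma real_psd_iff_realify_vec:
  assumes M: "M \<in> carrier_mat (n + n) (n + n)" and "transpose_mat M = M"
  shows "real_psd M \<longleftrightarrow> (\<forall>z \<in> carrier_vec n. 0 \<le> realify_vec z \<bullet> (M *\<^sub>v realify_vec z))"
  using assms by (simp add: real_psd_def flip: realify_vec_image)

text \<open>At \<open>realify_vec z\<close> the identity block contributes the squared norm times
  \<open>w\<close> and the realification contributes the form of \<open>H\<close>. The two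
  conditions are thus the two halves of an absolute value bound.\<close>

lemma real_psd_realification_iff:
  fixes w :: real
  assumes herm: "hermitian_mat n H"
  shows "real_psd (w \<cdot>\<^sub>m 1\<^sub>m (n + n) - realification H) \<longleftrightarrow>
           (\<forall>z \<in> carrier_vec n. Re ((H *\<^sub>v z) \<bullet>c z) \<le> w * Re (z \<bullet>c z))"
    and "real_psd (w \<cdot>\<^sub>m 1\<^sub>m (n + n) + realification H) \<longleftrightarrow>
           (\<forall>z \<in> carrier_vec n. - Re ((H *\<^sub>v z) \<bullet>c z) \<le> w * Re (z \<bullet>c z))"
proof -
  have H: "H \<in> carrier_mat n n" using herm by (simp add: hermitian_mat_def)
  let ?R = "realification H" and ?I = "w \<cdot>\<^sub>m 1\<^sub>m (n + n) :: real mat"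
  have R: "?R \<in> carrier_mat (n + n) (n + n)" and I: "?I \<in> carrier_mat (n + n) (n + n)"
    using H by simp_all
  have sym: "transpose_mat (?I - ?R) = ?I - ?R" "transpose_mat (?I + ?R) = ?I + ?R"
  proof -
    have "?R $$ (i, j) = ?R $$ (j, i)" if "i < n + n" "j < n + n" for i j
      using transpose_realification[OF herm] that R by (metis carrier_matD index_transpose_mat(1))
    then show "transpose_mat (?I - ?R) = ?I - ?R" "transpose_mat (?I + ?R) = ?I + ?R"
      using R by (auto intro!: eq_matI)
  qed
  have form: "realify_vec z \<bullet> ((?I - ?R) *\<^sub>v realify_vec z) = w * Re (z \<bullet>c z) - Re ((H *\<^sub>v z) \<bullet>c z)"
      "realify_vec z \<bullet> ((?I + ?R) *\<^sub>v realify_vec z) = w * Re (z \<bullet>c z) + Re ((H *\<^sub>v z) \<bullet>c z)"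
    if z: "z \<in> carrier_vec n" for z
  proof -
    let ?v = "realify_vec z" and ?u = "realify_vec (H *\<^sub>v z)"
    have Hz: "H *\<^sub>v z \<in> carrier_vec n" using H z by auto
    have v: "?v \<in> carrier_vec (n + n)" and u: "?u \<in> carrier_vec (n + n)"
      using z Hz by simp_all
    have Iv: "?I *\<^sub>v ?v = w \<cdot>\<^sub>v ?v"
      using v by (intro eq_vecI) auto
    have vv: "?v \<bullet> (w \<cdot>\<^sub>v ?v) = w * Re (z \<bullet>c z)"
      using v realify_vec_scalar_prod[OF z z] by simp
    have vu: "?v \<bullet> ?u = Re ((H *\<^sub>v z) \<bullet>c z)"
      by (rule realify_vec_scalar_prod[OF Hz z])
    show "?v \<bullet> ((?I - ?R) *\<^sub>v ?v) = w * Re (z \<bullet>c z) - Re ((H *\<^sub>v z) \<bullet>c z)"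
      using v u by (simp only: minus_mult_distrib_mat_vec[OF I R v] Iv vv vu smult_carrier_vec
          realification_mult_realify_vec[OF H z] scalar_prod_minus_distrib[of _ "n + n"])
    show "?v \<bullet> ((?I + ?R) *\<^sub>v ?v) = w * Re (z \<bullet>c z) + Re ((H *\<^sub>v z) \<bullet>c z)"
      using v u by (simp only: add_mult_distrib_mat_vec[OF I R v] Iv vv vu smult_carrier_vec
          realification_mult_realify_vec[OF H z] scalar_prod_add_distrib[of _ "n + n"])
  qed
  show "real_psd (?I - ?R) \<longleftrightarrow> (\<forall>z \<in> carrier_vec n. Re ((H *\<^sub>v z) \<bullet>c z) \<le> w * Re (z \<bullet>c z))"
    using R by (subst real_psd_iff_realify_vec[of _ n]) (simp_all add: sym form minus_carrier_mat)
  show "real_psd (?I + ?R) \<longleftrightarrow> (\<forall>z \<in> carrier_vec n. - Re ((H *\<^sub>v z) \<bullet>c z) \<le> w * Re (z \<bullet>c z))"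
    using R by (subst real_psd_iff_realify_vec[of _ n])
      (auto simp: sym form algebra_simps neg_le_iff_le)
qed

section \<open>The semidefinite program\<close>

lemma hermitian_mat_A_shift:
  assumes "hermitian_mat n A0" "x \<in> carrier_vec n"
  shows "hermitian_mat n (A_shift A0 x)"
  using assms by (auto simp: hermitian_mat_iff A_shift_def Diag_def mat_diag_def)

text \<open>The diagonal shift is real, so it enters only the two diagonal blocks.\<close>

lemma A_bar_eq_realification:
  assumes "A0 \<in> carrier_mat n n" "x \<in> carrier_vec n"
  shows "A_bar n A0 x = realification (A_shift A0 x)"
  using assms
  by (intro eq_matI) (auto simp: A_bar_def realification_def A_shift_def Diag_def mat_diag_def)

text \<open>The feasible set is the epigraph of the largest absolute eigenvalue; the equivalence of
  the two problems uses nothing else about the constraints.\<close>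

lemma sdp_feasible_iff:
  assumes n: "n \<ge> 1" and herm: "hermitian_mat n A0"
  shows "(w, x) \<in> sdp_feasible n A0 \<longleftrightarrow> x \<in> carrier_vec n \<and> max_abs_eigenvalue A0 x \<le> w"
proof (cases "x \<in> carrier_vec n")
  case True
  have "A_bar n A0 x = realification (A_shift A0 x)"
    using herm True by (simp add: hermitian_mat_def A_bar_eq_realification)
  moreover have "hermitian_mat n (A_shift A0 x)"
    using hermitian_mat_A_shift[OF herm True] .
  ultimately show ?thesis
    using True n
    by (auto simp: sdp_feasible_def real_psd_realification_iff max_abs_eigenvalue_def
        hermitian_mat_spectral_radius_le_iff abs_le_iff)
qed (simp add: sdp_feasible_def)

theorem proposition2:
  fixes n :: nat and A0 :: "complex mat"
  assumes "n \<ge> 1" and "hermitian_mat n A0"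
  shows "optimal_value (max_abs_eigenvalue A0) (carrier_vec n)
           = optimal_value fst (sdp_feasible n A0) \<and>
         (\<forall>x \<in> carrier_vec n.
            solves (max_abs_eigenvalue A0) (carrier_vec n) x \<longleftrightarrow>
            solves fst (sdp_feasible n A0) (max_abs_eigenvalue A0 x, x))"
proof (intro conjI ballI)
  note feasible = sdp_feasible_iff[OF assms]
  show "optimal_value (max_abs_eigenvalue A0) (carrier_vec n) = optimal_value fst (sdp_feasible n A0)"
    unfolding optimal_value_def
  \<comment> \<open>Each feasible pair costs at least the value at its own \<open>x\<close>, and
    each \<open>x\<close> lifts to a feasible pair of equal cost. The infima therefore agree whether
    or not they are attained.\<close>
  proof (rule antisym)
    show "(INF x\<in>carrier_vec n. ereal (max_abs_eigenvalue A0 x))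
            \<le> (INF p\<in>sdp_feasible n A0. ereal (fst p))"
    proof (rule INF_mono)
      fix p assume "p \<in> sdp_feasible n A0"
      then show "\<exists>x\<in>carrier_vec n. ereal (max_abs_eigenvalue A0 x) \<le> ereal (fst p)"
        by (cases p) (auto simp: feasible)
    qed
    show "(INF p\<in>sdp_feasible n A0. ereal (fst p))
            \<le> (INF x\<in>carrier_vec n. ereal (max_abs_eigenvalue A0 x))"
    proof (rule INF_mono)
      fix x :: "real vec" assume "x \<in> carrier_vec n"
      then show "\<exists>p\<in>sdp_feasible n A0. ereal (fst p) \<le> ereal (max_abs_eigenvalue A0 x)"
        by (intro bexI[of _ "(max_abs_eigenvalue A0 x, x)"]) (simp_all add: feasible)
    qed
  qed
  fix x :: "real vec" assume x: "x \<in> carrier_vec n"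
  \<comment> \<open>The same two comparisons transfer minimality: a better vector lifts to a better
    pair, and a better pair projects to a better vector.\<close>
  show "solves (max_abs_eigenvalue A0) (carrier_vec n) x \<longleftrightarrow>
          solves fst (sdp_feasible n A0) (max_abs_eigenvalue A0 x, x)"
    using x by (fastforce simp: solves_def is_arg_min_def feasible)
qed

end
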